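(* Let $V$ be a finite set and let $k$ be a positive integer. Let $\mathcal{F}\subseteq 2^V$ be the complement of a $k$-hierarchical lattice, and let $f:2^V\to\mathbb{Z}$ be a submodular function. Let $X^*\in\mathcal{F}$ be a minimizer of $f$ over $\mathcal{F}$. Then there exist $S,T\subseteq V$ with $S\cap T=\emptyset$ and $\max\{|S|,|T|\}\le k$ such that $X^*$ is a minimizer of $f$ over the lattice $[S,T]$.
   Context: A set function $f:2^V\to\mathbb{Z}$ is submodular if $f(X)+f(Y)\ge f(X\cup Y)+f(X\cap Y)$ for all $X,Y\subseteq V$. A family $\mathcal{H}\subseteq 2^V$ is a $k$-hierarchical lattice if there exists a chain of families $\emptyset=\mathcal{H}_0\subseteq\mathcal{H}_1\subseteq\cdots\subseteq\mathcal{H}_k=\mathcal{H}$ (where $\mathcal{H}_0$ is the empty family) such that for all $i=1,\ldots,k$ and all $X,Y\in\mathcal{H}_i\setminus\mathcal{H}_{i-1}$, either both $X\cup Y$ and $X\cap Y$ belong to $\mathcal{H}_i\setminus\mathcal{H}_{i-1}$, or at least one of $X\cup Y$, $X\cap Y$ belongs to $\mathcal{H}_{i-1}$. A family $\mathcal{F}\subseteq 2^V$ is the complement of a $k$-hierarchical lattice if $2^V\setminus\mathcal{F}$ is a $k$-hierarchical lattice. For disjoint $S,T\subseteq V$, $[S,T]:=\{X\subseteq V\mid S\subseteq X\subseteq V\setminus T\}$. A family of sets is called a lattice if it is closed under union and intersection of two members. A minimizer of $f$ over a family $\mathcal{G}\subseteq 2^V$ is a set $X\in\mathcal{G}$ with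 $f(X)\le f(Y)$ for all $Y\in\mathcal{G}$ (in particular it is a member of $\mathcal{G}$). *)

theory Defs
  imports Main
begin

text \<open>
  The ground set is an explicit carrier \<open>V\<close>. A set function on the subsets of \<open>V\<close> is a total
  function of which only the values on \<open>Pow V\<close> matter.
\<close>

definition submodular_on :: "'a set \<Rightarrow> ('a set \<Rightarrow> int) \<Rightarrow> bool" where
  "submodular_on V f \<longleftrightarrow>
     (\<forall>X Y. X \<subseteq> V \<longrightarrow> Y \<subseteq> V \<longrightarrow> f X + f Y \<ge> f (X \<union> Y) + f (X \<inter> Y))"

definition hierarchical_lattice :: "'a set \<Rightarrow> nat \<Rightarrow> 'a set set \<Rightarrow> bool" where
  "hierarchical_lattice V k H \<longleftrightarrow>
     H \<subseteq> Pow V \<and>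
     (\<exists>C :: nat \<Rightarrow> 'a set set.
        C 0 = {} \<and> C k = H \<and>
        (\<forall>i\<in>{1..k}. C (i - 1) \<subseteq> C i) \<and>
        (\<forall>i\<in>{1..k}. \<forall>X\<in>C i - C (i - 1). \<forall>Y\<in>C i - C (i - 1).
           (X \<union> Y \<in> C i - C (i - 1) \<and> X \<inter> Y \<in> C i - C (i - 1)) \<or>
           X \<union> Y \<in> C (i - 1) \<or> X \<inter> Y \<in> C (i - 1)))"

definition hierarchical_lattice_complement :: "'a set \<Rightarrow> nat \<Rightarrow> 'a set set \<Rightarrow> bool" where
  "hierarchical_lattice_complement V k F \<longleftrightarrow>
     F \<subseteq> Pow V \<and> hierarchical_lattice V k (Pow V - F)"

definition set_interval :: "'a set \<Rightarrow> 'a set \<Rightarrow> 'a set \<Rightarrow> 'a set set" where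
  "set_interval V S T = {X. S \<subseteq> X \<and> X \<subseteq> V - T}"

definition minimizer_over :: "('a set \<Rightarrow> int) \<Rightarrow> 'a set set \<Rightarrow> 'a set \<Rightarrow> bool" where
  "minimizer_over f G X \<longleftrightarrow> is_arg_min f (\<lambda>Y. Y \<in> G) X"

lemma minimizer_over_iff:
  "minimizer_over f G X \<longleftrightarrow> X \<in> G \<and> (\<forall>Y\<in>G. f X \<le> f Y)"
  by (auto simp: minimizer_over_def is_arg_min_linorder)

end

(* It suffices that some interval [S, T] around Xstar with |S|, |T| \<le> k misses H = Pow V - F. If all
   of them met H, then going down the chain every such interval with |S|, |T| \<le> i would meet H_i:
   if [S, T] with |S|, |T| \<le> i - 1 missed H_(i-1), the members of H_i in [S, T] would be closed under
   union and intersection, and by the bound for i they separate each point of Xstar from each point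
   outside, so Xstar itself would lie in H_i. For i = 0 this contradicts H_0 = {}. *)

theory Submission
  imports Defs
begin

lemma Inter_mem_closed:
  assumes "finite \<B>" "\<B> \<noteq> {}" "\<B> \<subseteq> \<G>"
    and "\<And>X Y. X \<in> \<G> \<Longrightarrow> Y \<in> \<G> \<Longrightarrow> X \<inter> Y \<in> \<G>"
  shows "\<Inter>\<B> \<in> \<G>"
  using assms(1-3) by (induction rule: finite_ne_induct) (auto simp: assms(4))

lemma Union_mem_closed:
  assumes "finite \<B>" "\<B> \<noteq> {}" "\<B> \<subseteq> \<G>"
    and "\<And>X Y. X \<in> \<G> \<Longrightarrow> Y \<in> \<G> \<Longrightarrow> X \<union> Y \<in> \<G>"
  shows "\<Union>\<B> \<in> \<G>"
  using assms(1-3) by (induction rule: finite_ne_induct) (auto simp: assms(4))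

lemma card_insert_le_Suc:
  assumes "card A \<le> n"
  shows "card (insert a A) \<le> Suc n"
  using assms by (metis card_insert_le_m1 diff_Suc_1 zero_less_Suc)

text \<open>The separating set is also demanded without an extra point on either side, which keeps the
  lemma true for \<open>A = {}\<close> and \<open>A = V\<close>.\<close>

lemma mem_lattice_if_separated:
  assumes "finite \<G>" "\<G> \<subseteq> Pow V" "A \<subseteq> V"
    and Int: "\<And>X Y. X \<in> \<G> \<Longrightarrow> Y \<in> \<G> \<Longrightarrow> X \<inter> Y \<in> \<G>"
    and Un: "\<And>X Y. X \<in> \<G> \<Longrightarrow> Y \<in> \<G> \<Longrightarrow> X \<union> Y \<in> \<G>"
    and sep: "\<And>S T. S \<subseteq> A \<Longrightarrow> T \<subseteq> V - A \<Longrightarrow> S = {} \<or> is_singleton S \<Longrightarrow>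
      T = {} \<or> is_singleton T \<Longrightarrow> \<exists>Y\<in>\<G>. S \<subseteq> Y \<and> Y \<inter> T = {}"
  shows "A \<in> \<G>"
proof -
  \<comment> \<open>Intersecting all members that contain \<open>S\<close> leaves no point outside
    \<open>A\<close>, since each such point is avoided by one of them.\<close>
  have below: "\<exists>M\<in>\<G>. S \<subseteq> M \<and> M \<subseteq> A" if S: "S \<subseteq> A" "S = {} \<or> is_singleton S" for S
  proof -
    define \<B> where "\<B> = {Y \<in> \<G>. S \<subseteq> Y}"
    have sepB: "\<exists>Y\<in>\<B>. Y \<inter> T = {}" if "T \<subseteq> V - A" "T = {} \<or> is_singleton T" for T
      using sep[OF S(1) that(1) S(2) that(2)] by (auto simp: \<B>_def)
    \<comment> \<open>The choice \<open>T = {}\<close> yields a member even when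
      \<open>A = V\<close>, so that the intersection is not the degenerate
      \<open>UNIV\<close>.\<close>
    have ne: "\<B> \<noteq> {}"
      using sepB[of "{}"] by auto
    have mem: "\<Inter>\<B> \<in> \<G>"
      by (rule Inter_mem_closed[OF _ ne _ Int]) (use assms(1) in \<open>auto simp: \<B>_def\<close>)
    have "\<Inter>\<B> \<subseteq> A"
    proof
      fix t assume t: "t \<in> \<Inter>\<B>"
      show "t \<in> A"
      proof (rule ccontr)
        assume "t \<notin> A"
        moreover have "t \<in> V" using t mem assms(2) by blast
        ultimately obtain Y where "Y \<in> \<B>" "Y \<inter> {t} = {}"
          using sepB[of "{t}"] by auto
        with t show False by auto
      qed
    qed
    moreover have "S \<subseteq> \<Inter>\<B>" by (auto simp: \<B>_def)
    ultimately show ?thesis using mem by blast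
  qed
  \<comment> \<open>By \<open>below\<close>, each point of \<open>A\<close> lies in a member inside
    \<open>A\<close>, so these members have union \<open>A\<close>; the case \<open>S = {}\<close>
    makes \<open>\<B>\<close> nonempty also for \<open>A = {}\<close>.\<close>
  define \<B> where "\<B> = {M \<in> \<G>. M \<subseteq> A}"
  have ne: "\<B> \<noteq> {}"
    using below[of "{}"] by (auto simp: \<B>_def)
  have "\<Union>\<B> \<in> \<G>"
    by (rule Union_mem_closed[OF _ ne _ Un]) (use assms(1) in \<open>auto simp: \<B>_def\<close>)
  moreover have "\<Union>\<B> = A"
  proof
    show "A \<subseteq> \<Union>\<B>"
    proof
      fix s assume "s \<in> A"
      then show "s \<in> \<Union>\<B>" using below[of "{s}"] by (auto simp: \<B>_def)
    qed
  qed (auto simp: \<B>_def)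
  ultimately show ?thesis by simp
qed

text \<open>If \<open>[S, T]\<close> missed \<open>H'\<close>, its members in \<open>H\<close> would
  form a lattice. Separating a point of \<open>A\<close> from a point outside uses one extra element
  on each side, which is why \<open>Suc n\<close> drops to \<open>n\<close>; the lattice would then
  contain \<open>A\<close>, against \<open>A \<notin> H\<close>.\<close>

lemma hierarchical_step:
  assumes "finite V" "A \<subseteq> V" "A \<notin> H" "H \<subseteq> Pow V"
    and step: "\<forall>X\<in>H - H'. \<forall>Y\<in>H - H'. (X \<union> Y \<in> H - H' \<and> X \<inter> Y \<in> H - H') \<or>
      X \<union> Y \<in> H' \<or> X \<inter> Y \<in> H'"
    and meets: "\<And>S T. S \<subseteq> A \<Longrightarrow> T \<subseteq> V - A \<Longrightarrow> card S \<le> Suc n \<Longrightarrow> card T \<le> Suc n \<Longrightarrow>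
      set_interval V S T \<inter> H \<noteq> {}"
    and ST: "S \<subseteq> A" "T \<subseteq> V - A" "card S \<le> n" "card T \<le> n"
  shows "set_interval V S T \<inter> H' \<noteq> {}"
proof
  assume miss: "set_interval V S T \<inter> H' = {}"
  define \<G> where "\<G> = set_interval V S T \<inter> H"
  have "X \<inter> Y \<in> \<G> \<and> X \<union> Y \<in> \<G>" if "X \<in> \<G>" "Y \<in> \<G>" for X Y
  proof -
    have "X \<union> Y \<in> set_interval V S T" "X \<inter> Y \<in> set_interval V S T"
      using that by (auto simp: \<G>_def set_interval_def)
    moreover have "X \<in> H - H'" "Y \<in> H - H'"
      using that miss by (auto simp: \<G>_def)
    \<comment> \<open>The union and the intersection stay in the interval, which misses
      \<open>H'\<close>; this excludes the last two alternatives of \<open>step\<close>.\<close>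
    ultimately show ?thesis
      using step miss unfolding \<G>_def by blast
  qed
  moreover have "\<exists>Y\<in>\<G>. S' \<subseteq> Y \<and> Y \<inter> T' = {}"
    if *: "S' \<subseteq> A" "T' \<subseteq> V - A" "S' = {} \<or> is_singleton S'" "T' = {} \<or> is_singleton T'" for S' T'
  proof -
    have "card (S' \<union> S) \<le> Suc n" "card (T' \<union> T) \<le> Suc n"
      using *(3,4) ST(3,4) by (auto simp: is_singleton_def card_insert_le_Suc)
    then obtain Y where "Y \<in> set_interval V (S' \<union> S) (T' \<union> T)" "Y \<in> H"
      using meets[of "S' \<union> S" "T' \<union> T"] *(1,2) ST(1,2) by blast
    then show ?thesis
      by (intro bexI[of _ Y]) (auto simp: \<G>_def set_interval_def)
  qed
  moreover have "\<G> \<subseteq> Pow V"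
    using assms(4) by (auto simp: \<G>_def)
  ultimately have "A \<in> \<G>"
    using assms(1,2) finite_subset[of \<G> "Pow V"]
    by (intro mem_lattice_if_separated[of \<G> V A]) auto
  with assms(3) show False by (simp add: \<G>_def)
qed

text \<open>Each of the \<open>k\<close> levels of the chain costs one element of \<open>S\<close>
  and one of \<open>T\<close>, so a budget of \<open>k\<close> on both sides lasts down to the empty
  family.\<close>

lemma hierarchical_lattice_misses_interval:
  assumes "finite V" "hierarchical_lattice V k H" "A \<subseteq> V" "A \<notin> H"
  shows "\<exists>S T. S \<subseteq> A \<and> T \<subseteq> V - A \<and> card S \<le> k \<and> card T \<le> k \<and> set_interval V S T \<inter> H = {}"
proof (rule ccontr)
  assume none: "\<not> ?thesis"
  have top: "set_interval V S T \<inter> H \<noteq> {}"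
    if "S \<subseteq> A" "T \<subseteq> V - A" "card S \<le> k" "card T \<le> k" for S T
    using that none by blast
  obtain C where H: "H \<subseteq> Pow V" and C: "C 0 = {}" "C k = H"
    "\<And>i. i \<in> {1..k} \<Longrightarrow> C (i - 1) \<subseteq> C i"
    "\<And>i. i \<in> {1..k} \<Longrightarrow> \<forall>X\<in>C i - C (i - 1). \<forall>Y\<in>C i - C (i - 1).
           (X \<union> Y \<in> C i - C (i - 1) \<and> X \<inter> Y \<in> C i - C (i - 1)) \<or>
           X \<union> Y \<in> C (i - 1) \<or> X \<inter> Y \<in> C (i - 1)"
    using assms(2) unfolding hierarchical_lattice_def by metis
  \<comment> \<open>Downward induction from \<open>k\<close>. The inclusion is carried along because
    each step needs \<open>A \<notin> C (Suc n)\<close>, while the chain only compares neighbouring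
    levels.\<close>
  have "C i \<subseteq> H \<and> (\<forall>S T. S \<subseteq> A \<longrightarrow> T \<subseteq> V - A \<longrightarrow> card S \<le> i \<longrightarrow> card T \<le> i \<longrightarrow>
      set_interval V S T \<inter> C i \<noteq> {})" if "i \<le> k" for i
    using that
  proof (induction rule: inc_induct)
    case base
    then show ?case using top C(2) by simp
  next
    case (step n)
    then have i: "Suc n \<in> {1..k}" by simp
    have IH: "C (Suc n) \<subseteq> H" and meets: "\<And>S T. S \<subseteq> A \<Longrightarrow> T \<subseteq> V - A \<Longrightarrow> card S \<le> Suc n \<Longrightarrow>
        card T \<le> Suc n \<Longrightarrow> set_interval V S T \<inter> C (Suc n) \<noteq> {}"
      using step.IH by blast+
    have "set_interval V S T \<inter> C n \<noteq> {}"
      if "S \<subseteq> A" "T \<subseteq> V - A" "card S \<le> n" "card T \<le> n" for S T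
      by (rule hierarchical_step[OF assms(1,3) _ _ _ meets that])
        (use IH H assms(4) C(4)[OF i] in auto)
    moreover have "C n \<subseteq> H" using C(3)[OF i] IH by simp
    ultimately show ?case by blast
  qed
  \<comment> \<open>At level 0 the choice \<open>S = T = {}\<close> is within the bounds, yet
    nothing meets \<open>C 0 = {}\<close>.\<close>
  from this[of 0] C(1) show False by (metis card.empty empty_subsetI inf_bot_right le0)
qed

theorem theorem2p1:
  fixes V :: "'a set" and k :: nat and F :: "'a set set"
    and f :: "'a set \<Rightarrow> int" and Xstar :: "'a set"
  assumes "finite V"
    and "k > 0"
    and "hierarchical_lattice_complement V k F"
    and "submodular_on V f"
    and "minimizer_over f F Xstar"
  shows "\<exists>S T. S \<subseteq> V \<and> T \<subseteq> V \<and> S \<inter> T = {} \<and> max (card S) (card T) \<le> k \<and>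
           minimizer_over f (set_interval V S T) Xstar"
proof -
  have X: "Xstar \<in> F" and min: "\<And>Y. Y \<in> F \<Longrightarrow> f Xstar \<le> f Y"
    using assms(5) by (auto simp: minimizer_over_iff)
  have XV: "Xstar \<subseteq> V" and H: "hierarchical_lattice V k (Pow V - F)"
    using assms(3) X by (auto simp: hierarchical_lattice_complement_def)
  obtain S T where ST: "S \<subseteq> Xstar" "T \<subseteq> V - Xstar" "card S \<le> k" "card T \<le> k"
    and miss: "set_interval V S T \<inter> (Pow V - F) = {}"
    using hierarchical_lattice_misses_interval[OF assms(1) H XV] X by blast
  \<comment> \<open>Minimality over \<open>F\<close> passes to any subfamily that still contains
    \<open>Xstar\<close>.\<close>
  have "set_interval V S T \<subseteq> F"
    using miss by (auto simp: set_interval_def)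
  moreover have "Xstar \<in> set_interval V S T"
    using ST XV by (auto simp: set_interval_def)
  ultimately have "minimizer_over f (set_interval V S T) Xstar"
    using min by (auto simp: minimizer_over_iff)
  with ST XV show ?thesis
    by (intro exI[of _ S] exI[of _ T]) auto
qed

end
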